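(* Every nonadaptive, 1-sided error $\varepsilon$-tester for connectedness of images must query $\Omega\!\left(\frac1\varepsilon\log\frac1\varepsilon\right)$ pixels (on some family of images).
   Context: An $N\times N$ image is a binary matrix $M$ indexed by $\{0,\dots,N-1\}^2$, where $1$ means black and $0$ means white. The image graph $G_M$ has as vertices the black pixels, with an edge between $(i,j)$ and $(i',j')$ iff $|i-i'|+|j-j'|=1$. $M$ is connected if $G_M$ is connected. $M$ is $\varepsilon$-far from connected if at least $\varepsilon N^2$ pixels must be changed to obtain a connected image. A 1-sided error $\varepsilon$-tester for connectedness, given query access to $M$, accepts every connected image with probability 1 and rejects every image that is $\varepsilon$-far from connected with probability at least $2/3$. It is nonadaptive if it chooses all its queries before receiving any answers. *)

theory Defs
  imports "HOL-Probability.Probability"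
begin

type_synonym pixel = "nat \<times> nat"

text \<open>Images are binary matrices with \<open>True\<close> for black (1) and \<open>False\<close> for white (0).\<close>
type_synonym image = "pixel \<Rightarrow> bool"

definition pixels :: "nat \<Rightarrow> pixel set" where
  "pixels N = {..<N} \<times> {..<N}"

definition images :: "nat \<Rightarrow> image set" where
  "images N = pixels N \<rightarrow>\<^sub>E UNIV"

definition black_pixels :: "nat \<Rightarrow> image \<Rightarrow> pixel set" where
  "black_pixels N M = {p \<in> pixels N. M p}"

definition image_edges :: "nat \<Rightarrow> image \<Rightarrow> (pixel \<times> pixel) set" where
  "image_edges N M =
     {((i, j), (i', j')) | i j i' j'.
        (i, j) \<in> black_pixels N M \<and> (i', j') \<in> black_pixels N M \<and>
        \<bar>int i - int i'\<bar> + \<bar>int j - int j'\<bar> = 1}"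

text \<open>Any two black pixels are joined by a path in the image graph.  The all-white image, whose
  graph has no vertices, counts as connected.\<close>
definition connected_image :: "nat \<Rightarrow> image \<Rightarrow> bool" where
  "connected_image N M \<longleftrightarrow>
     (\<forall>p \<in> black_pixels N M. \<forall>q \<in> black_pixels N M. (p, q) \<in> (image_edges N M)\<^sup>*)"

definition far_from_connected :: "nat \<Rightarrow> real \<Rightarrow> image \<Rightarrow> bool" where
  "far_from_connected N \<epsilon> M \<longleftrightarrow>
     (\<forall>M' \<in> images N. connected_image N M' \<longrightarrow>
        real (card {p \<in> pixels N. M p \<noteq> M' p}) \<ge> \<epsilon> * (real N)\<^sup>2)"

text \<open>A randomized nonadaptive algorithm is a distribution over deterministic ones.  A deterministic
  nonadaptive algorithm is a set of queried pixels, fixed in advance, together with a decision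
  (\<open>True\<close> means accept) that is a function of the answers, i.e. of the restriction of the image to
  the queried pixels.\<close>
type_synonym nonadaptive_algorithm = "(pixel set \<times> ((pixel \<Rightarrow> bool) \<Rightarrow> bool)) pmf"

definition queries_within :: "nat \<Rightarrow> nonadaptive_algorithm \<Rightarrow> bool" where
  "queries_within N T \<longleftrightarrow> (\<forall>(Q, D) \<in> set_pmf T. Q \<subseteq> pixels N)"

definition accept_prob :: "nonadaptive_algorithm \<Rightarrow> image \<Rightarrow> real" where
  "accept_prob T M = measure_pmf.prob T {(Q, D). D (restrict M Q)}"

definition reject_prob :: "nonadaptive_algorithm \<Rightarrow> image \<Rightarrow> real" where
  "reject_prob T M = measure_pmf.prob T {(Q, D). \<not> D (restrict M Q)}"

definition one_sided_nonadaptive_tester :: "nat \<Rightarrow> real \<Rightarrow> nonadaptive_algorithm \<Rightarrow> bool" where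
  "one_sided_nonadaptive_tester N \<epsilon> T \<longleftrightarrow>
     queries_within N T \<and>
     (\<forall>M \<in> images N. connected_image N M \<longrightarrow> accept_prob T M = 1) \<and>
     (\<forall>M \<in> images N. far_from_connected N \<epsilon> M \<longrightarrow> reject_prob T M \<ge> 2 / 3)"

text \<open>Worst case over the random choices.  The maximum exists if \<^term>\<open>queries_within N T\<close>, since then
  all the cardinalities are at most \<open>N\<^sup>2\<close>.\<close>
definition query_complexity :: "nonadaptive_algorithm \<Rightarrow> nat" where
  "query_complexity T = Max ((\<lambda>(Q, D). card Q) ` set_pmf T)"

end

theory Submission
  imports Defs
begin

text \<open>
  Let \<open>2\<^sup>K\<close> be of order \<open>1/\<epsilon>\<close> and cut the image into vertical strips of width \<open>2\<^sup>K\<close>.  A hard image of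
  level \<open>i\<close> fills a \<open>2\<^sup>-\<^sup>i\<close> fraction of the strips (a residue class modulo \<open>2\<^sup>i\<close>) with isolated black
  horizontal segments of length about \<open>w = 2\<^sup>K\<^sup>-\<^sup>i\<close>; everything else is black.  At every level there
  are of order \<open>\<epsilon>N\<^sup>2\<close> segments, so the image is far from connected.  One unqueried pixel directly
  above each segment suffices to connect the image consistently with the answers, so a 1-sided tester
  can only reject if it has queried about \<open>w\<close> pixels in one of the filled strips.  If a strip receives
  \<open>q\<close> queries, this is possible only at the levels with \<open>2\<^sup>-\<^sup>i \<le> 2q/2\<^sup>K\<close>, and the probability that the
  strip is filled at such a level is \<open>2\<^sup>-\<^sup>i\<close>.  Summed over these levels the strip contributes a
  geometric series of size \<open>O(\<epsilon>q)\<close>, so the rejection probabilities of all \<open>K - 1\<close> levels add up to at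
  most \<open>O(\<epsilon>)\<close> times the number of queries, while each of them has to be at least \<open>2/3\<close>.
\<close>

section \<open>Striped images and how to connect them\<close>

text \<open>The two end columns of a tile are left out so that, below row 0, they separate its
  segments from the adjacent tiles.\<close>

definition interior_col :: "nat \<Rightarrow> nat \<Rightarrow> bool" where
  "interior_col w c \<longleftrightarrow> 0 < c mod w \<and> Suc (c mod w) < w"

text \<open>\<open>J\<close> is the set of tiles, that is, column blocks of width \<open>w\<close>, carrying the pattern.  The black
  row \<open>0\<close> joins the topmost segments once the white pixels above them are opened.\<close>

definition striped_image :: "nat \<Rightarrow> nat \<Rightarrow> nat set \<Rightarrow> image" where
  "striped_image N w J =
     (\<lambda>(r, c) \<in> pixels N. r = 0 \<or> c div w \<notin> J \<or> (even r \<and> interior_col w c))"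

lemma striped_image_in_images: "striped_image N w J \<in> images N"
  by (simp add: striped_image_def images_def)

lemma image_edges_sym: "(p, q) \<in> image_edges N M \<Longrightarrow> (q, p) \<in> image_edges N M"
  unfolding image_edges_def by fastforce

lemma image_edges_rtrancl_sym:
  assumes "(p, q) \<in> (image_edges N M)\<^sup>*"
  shows "(q, p) \<in> (image_edges N M)\<^sup>*"
proof -
  have "sym (image_edges N M)"
    by (meson image_edges_sym symI)
  then show ?thesis
    using assms by (meson sym_rtrancl symD)
qed

lemma image_edge_up:
  assumes "(Suc r, c) \<in> black_pixels N M" "(r, c) \<in> black_pixels N M"
  shows "((Suc r, c), (r, c)) \<in> image_edges N M"
  using assms unfolding image_edges_def by simp

lemma image_edge_left:
  assumes "(r, Suc c) \<in> black_pixels N M" "(r, c) \<in> black_pixels N M"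
  shows "((r, Suc c), (r, c)) \<in> image_edges N M"
  using assms unfolding image_edges_def by simp

lemma horizontal_path_left:
  assumes "\<And>c. a \<le> c \<Longrightarrow> c \<le> b \<Longrightarrow> (r, c) \<in> black_pixels N M" "a \<le> b"
  shows "((r, b), (r, a)) \<in> (image_edges N M)\<^sup>*"
  using assms(2,1)
proof (induction b rule: dec_induct)
  case base
  then show ?case by simp
next
  case (step b)
  have "((r, Suc b), (r, b)) \<in> image_edges N M"
    using step by (intro image_edge_left) auto
  moreover have "((r, b), (r, a)) \<in> (image_edges N M)\<^sup>*"
    using step by auto
  ultimately show ?case
    by (rule converse_rtrancl_into_rtrancl)
qed

lemma horizontal_path:
  assumes "\<And>c. min a b \<le> c \<Longrightarrow> c \<le> max a b \<Longrightarrow> (r, c) \<in> black_pixels N M"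
  shows "((r, a), (r, b)) \<in> (image_edges N M)\<^sup>*"
proof (cases "a \<le> b")
  case True
  then show ?thesis
    using assms by (intro image_edges_rtrancl_sym[OF horizontal_path_left]) auto
next
  case False
  then show ?thesis
    using assms by (intro horizontal_path_left) auto
qed

lemma interior_col_between:
  assumes "interior_col w a" "interior_col w b" "a div w = b div w" "a \<le> c" "c \<le> b"
  shows "interior_col w c \<and> c div w = a div w"
proof -
  have d: "c div w = a div w"
    using assms(3-5) by (metis div_le_mono le_antisym)
  have "a = w * (a div w) + a mod w" "b = w * (a div w) + b mod w" "c = w * (a div w) + c mod w"
    using assms(3) d by (metis mult_div_mod_eq)+
  then have "a mod w \<le> c mod w" "c mod w \<le> b mod w"
    using assms(4,5) by linarith+
  then show ?thesis
    using assms(1,2) d unfolding interior_col_def by linarith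
qed

text \<open>Opening every unqueried interior pixel of the odd rows leaves all answers on
  \<open>Q\<close> unchanged. By \<open>gap\<close>, each segment then has an opening to the segment
  two rows higher, so every black pixel can climb to row 0.\<close>

lemma striped_image_patch:
  assumes J: "\<And>j. j \<in> J \<Longrightarrow> Suc j * w \<le> N"
    and gap: "\<And>r j. odd r \<Longrightarrow> j \<in> J \<Longrightarrow> \<exists>c. c div w = j \<and> interior_col w c \<and> (r, c) \<notin> Q"
  shows "\<exists>M' \<in> images N. connected_image N M' \<and>
           (\<forall>p \<in> Q \<inter> pixels N. M' p = striped_image N w J p)"
proof -
  define M' where "M' = (\<lambda>(r, c) \<in> pixels N. r = 0 \<or> c div w \<notin> J \<or>
      (interior_col w c \<and> (even r \<or> (r, c) \<notin> Q)))"
  have black: "(r, c) \<in> black_pixels N M' \<longleftrightarrow> r < N \<and> c < N \<and>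
      (r = 0 \<or> c div w \<notin> J \<or> (interior_col w c \<and> (even r \<or> (r, c) \<notin> Q)))" for r c
    by (auto simp: black_pixels_def pixels_def M'_def)
  let ?E = "image_edges N M'"
  \<comment> \<open>The column supplied by \<open>gap\<close> is not assumed to lie in the image;
    this follows because all tiles of \<open>J\<close> fit completely.\<close>
  have in_N: "c < N" if "c div w \<in> J" "interior_col w c" for c
  proof -
    have "0 < w" using that(2) by (simp add: interior_col_def)
    then have "c < Suc (c div w) * w"
      by (simp add: dividend_less_div_times)
    then show ?thesis using J[OF that(1)] by linarith
  qed
  have reach: "((r, c), (0, 0)) \<in> ?E\<^sup>*" if "(r, c) \<in> black_pixels N M'" for r c
    using that
  proof (induction r arbitrary: c rule: less_induct)
    case (less r)
    have up: ?case if "(r', c) \<in> black_pixels N M'" "r = Suc r'" for r'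
      using less.IH[of r' c] that less.prems image_edge_up[of r' c N M']
      by (auto intro: converse_rtrancl_into_rtrancl)
    consider "r = 0" | "0 < r" "c div w \<notin> J"
      | "0 < r" "c div w \<in> J" "interior_col w c" "odd r"
      | "0 < r" "c div w \<in> J" "interior_col w c" "even r"
      using less.prems by (auto simp: black)
    then show ?case
    proof cases
      case 1
      then show ?thesis
        using less.prems by (auto simp: black intro!: horizontal_path)
    next
      case 2
      then obtain r' where "r = Suc r'" by (cases r) auto
      then show ?thesis
        using 2 less.prems by (intro up[of r']) (auto simp: black)
    next
      \<comment> \<open>Directly above an opened pixel lies a segment pixel, or row 0.\<close>
      case 3
      then obtain r' where "r = Suc r'" by (cases r) auto
      then show ?thesis
        using 3 less.prems by (intro up[of r']) (auto simp: black)
    next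
      case 4
      then obtain r' where r': "r = Suc (Suc r')" "even r'"
        by (metis even_Suc gr0_implies_Suc odd_pos)
      \<comment> \<open>Walk along the segment to the column \<open>d\<close> of an opening, then go
        up two rows.\<close>
      obtain d where d: "d div w = c div w" "interior_col w d" "(Suc r', d) \<notin> Q"
        using gap[of "Suc r'" "c div w"] 4 r' by auto
      have r: "r < N" using less.prems by (simp add: black)
      have dJ: "d div w \<in> J" using d(1) 4(2) by simp
      have "((r, c), (r, d)) \<in> ?E\<^sup>*"
      proof (rule horizontal_path)
        fix x assume x: "min c d \<le> x" "x \<le> max c d"
        have "interior_col w x \<and> x div w = c div w"
        proof (cases "c \<le> d")
          case True
          then show ?thesis using interior_col_between[of w c d x] 4(3) d x by simp
        next
          case False
          then show ?thesis using interior_col_between[of w d c x] 4(3) d x by simp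
        qed
        then show "(r, x) \<in> black_pixels N M'"
          using in_N[of x] 4 r by (auto simp: black)
      qed
      moreover have "((Suc (Suc r'), d), (Suc r', d)) \<in> ?E"
        using r r' d in_N[OF dJ d(2)] by (intro image_edge_up) (auto simp: black)
      moreover have "((Suc r', d), (r', d)) \<in> ?E"
        using r r' d in_N[OF dJ d(2)] by (intro image_edge_up) (auto simp: black)
      moreover have "((r', d), (0, 0)) \<in> ?E\<^sup>*"
        using r r' d in_N[OF dJ d(2)] by (intro less.IH) (auto simp: black)
      ultimately show ?thesis
        using r'(1) by (meson converse_rtrancl_into_rtrancl rtrancl_trans)
    qed
  qed
  have "connected_image N M'"
    unfolding connected_image_def
    by (metis reach image_edges_rtrancl_sym rtrancl_trans surj_pair)
  moreover have "M' \<in> images N"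
    by (simp add: M'_def images_def)
  moreover have "\<forall>p \<in> Q \<inter> pixels N. M' p = striped_image N w J p"
    by (auto simp: M'_def striped_image_def)
  ultimately show ?thesis by blast
qed

section \<open>Distance of striped images from connectedness\<close>

lemma div_mod_tile:
  fixes t w j :: nat
  assumes "t < w"
  shows "(t + j * w) div w = j" "(t + j * w) mod w = t"
  using assms by simp_all

lemma interior_col_step:
  assumes "interior_col w c" "\<bar>int c - int c'\<bar> = 1"
  shows "c' div w = c div w"
proof -
  have w: "0 < w" "0 < c mod w" "Suc (c mod w) < w"
    using assms(1) by (auto simp: interior_col_def)
  have c: "c = c mod w + c div w * w" by simp
  consider "c' = Suc (c mod w) + c div w * w" | "c' = (c mod w - 1) + c div w * w"
    using assms(2) c w(2) by linarith
  then show ?thesis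
  proof cases
    case 1
    then show ?thesis using div_mod_tile(1)[OF w(3)] by metis
  next
    case 2
    have "c mod w - 1 < w" using w by linarith
    with 2 show ?thesis using div_mod_tile(1) by metis
  qed
qed

text \<open>The block of rows \<open>4 * u\<close> to \<open>4 * u + 3\<close> within a tile
  contains one whole segment, in row \<open>4 * u + 2\<close>, and every pixel adjacent to it. These
  adjacent pixels are white, so as long as the block is unchanged no path leaves the
  segment.\<close>

lemma unchanged_tile_traps_component:
  assumes agree: "\<And>r c. (r, c) \<in> pixels N \<Longrightarrow> r div 4 = u \<Longrightarrow> c div w = j \<Longrightarrow>
      M' (r, c) = striped_image N w J (r, c)"
    and "j \<in> J" "interior_col w c" "c div w = j"
    and "((4 * u + 2, c), q) \<in> (image_edges N M')\<^sup>*"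
  shows "fst q = 4 * u + 2 \<and> snd q div w = j"
proof -
  \<comment> \<open>The induction also carries interiority of the column, which keeps the next
    horizontal step inside the tile.\<close>
  have "fst q = 4 * u + 2 \<and> snd q div w = j \<and> interior_col w (snd q)"
    using assms(5)
  proof (induction rule: rtrancl_induct)
    case base
    then show ?case using assms by simp
  next
    case (step p q)
    obtain c where p: "p = (4 * u + 2, c)" "c div w = j" "interior_col w c"
      using step.IH by (cases p) auto
    obtain r' c' where q: "q = (r', c')" by (cases q)
    have black: "(r', c') \<in> pixels N" "M' (r', c')"
      and adj: "\<bar>int (4 * u + 2) - int r'\<bar> + \<bar>int c - int c'\<bar> = 1"
      using step.hyps(2) by (auto simp: image_edges_def black_pixels_def p(1) q)
    have r': "r' = 4 * u + 1 \<or> r' = 4 * u + 2 \<or> r' = 4 * u + 3"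
      using adj by linarith
    then have u: "r' div 4 = u" by auto
    have c': "c' div w = j"
    proof (cases "c' = c")
      case False
      then have "\<bar>int c - int c'\<bar> = 1" using adj by linarith
      then show ?thesis using interior_col_step p(2,3) by metis
    qed (use p in simp)
    have "even r' \<and> interior_col w c'"
      using agree[OF black(1) u c'] black \<open>j \<in> J\<close> c' r' by (auto simp: striped_image_def)
    then show ?case using r' c' q by auto
  qed
  then show ?thesis by simp
qed

text \<open>The blocks of four rows by one tile are disjoint, so one changed pixel affects at most
  one of them. Two unchanged blocks would contain segments in different components, so at most one
  block stays unchanged; it accounts for the \<open>Suc\<close>.\<close>

lemma striped_image_distance:
  assumes J: "\<And>j. j \<in> J \<Longrightarrow> Suc j * w \<le> N" and w: "3 \<le> w" and "finite J"
    and conn: "connected_image N M'"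
  shows "(N div 4) * card J \<le> Suc (card {p \<in> pixels N. striped_image N w J p \<noteq> M' p})"
proof -
  define D where "D = {p \<in> pixels N. striped_image N w J p \<noteq> M' p}"
  define T where "T = {..<N div 4} \<times> J"
  define tile where "tile = (\<lambda>(r, c). (r div 4, c div w) :: nat \<times> nat)"
  have finD: "finite D" by (simp add: D_def pixels_def)
  have finT: "finite T" using \<open>finite J\<close> by (simp add: T_def)
  have agree: "M' (r, c) = striped_image N w J (r, c)"
    if "(u, j) \<notin> tile ` D" "(r, c) \<in> pixels N" "r div 4 = u" "c div w = j" for u j r c
    using that by (force simp: D_def tile_def)
  have uniq: "t = t'" if t: "t \<in> T - tile ` D" "t' \<in> T - tile ` D" for t t'
  proof -
    obtain u j u' j' where tt: "t = (u, j)" "t' = (u', j')"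
      by (cases t, cases t')
    \<comment> \<open>Column 1 of a tile represents its segments; it is interior because
      \<open>3 \<le> w\<close>.\<close>
    have col: "interior_col w (1 + j * w)" "(1 + j * w) div w = j" for j
      using w div_mod_tile[of 1 w j] by (simp_all add: interior_col_def)
    have black: "(4 * u + 2, 1 + j * w) \<in> black_pixels N M'"
      if "(u, j) \<in> T" "(u, j) \<notin> tile ` D" for u j
    proof -
      have "u < N div 4" "j \<in> J" using that(1) by (auto simp: T_def)
      then have "(4 * u + 2, 1 + j * w) \<in> pixels N"
        using J[of j] w by (auto simp: pixels_def)
      moreover have "(4 * u + 2) div 4 = u" by simp
      ultimately show ?thesis
        using agree[OF that(2), of "4 * u + 2" "1 + j * w"] col[of j] \<open>j \<in> J\<close>
        by (simp add: black_pixels_def striped_image_def)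
    qed
    have "((4 * u + 2, 1 + j * w), (4 * u' + 2, 1 + j' * w)) \<in> (image_edges N M')\<^sup>*"
      using conn black[of u j] black[of u' j'] t tt unfolding connected_image_def by blast
    then have "4 * u' + 2 = 4 * u + 2 \<and> (1 + j' * w) div w = j"
      using unchanged_tile_traps_component[of N u w j M' J "1 + j * w" "(4 * u' + 2, 1 + j' * w)"]
        agree[of u j] col t tt by (auto simp: T_def)
    then show ?thesis using tt col by simp
  qed
  have "card T = card (T \<inter> tile ` D) + card (T - tile ` D)"
    using finT by (metis card_Int_Diff)
  also have "card (T - tile ` D) \<le> 1"
    using uniq finT by (simp add: card_le_Suc0_iff_eq)
  also have "card (T \<inter> tile ` D) \<le> card D"
    using finD by (meson card_image_le card_mono finite_imageI inf_le2 le_trans)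
  finally show ?thesis by (simp add: T_def D_def card_cartesian_product)
qed

section \<open>A geometric sum and the family of hard images\<close>

text \<open>The nonzero terms form a geometric series whose largest term is at most
  \<open>x\<close>.\<close>

lemma sum_large_reciprocal_powers:
  fixes x :: real
  assumes "0 \<le> x"
  shows "(\<Sum>i<m. if 1 / 2 ^ i \<le> x then 1 / 2 ^ i else 0) \<le> 2 * x"
  using assms
proof (induction m arbitrary: x)
  case (Suc m)
  \<comment> \<open>For \<open>x < 1\<close> the term at 0 vanishes and the rest is half of the same
    sum at \<open>2 * x\<close>, so the bound reproduces itself.\<close>
  have shift: "(\<Sum>i<m. if 1 / 2 ^ Suc i \<le> x then 1 / 2 ^ Suc i else (0::real))
      = (\<Sum>i<m. if 1 / 2 ^ i \<le> 2 * x then 1 / 2 ^ i else 0) / 2"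
    unfolding sum_divide_distrib by (intro sum.cong) (auto simp: field_simps)
  show ?case
  proof (cases "1 \<le> x")
    case True
    have "(\<Sum>i<Suc m. if 1 / 2 ^ i \<le> x then 1 / 2 ^ i else 0) \<le> (\<Sum>i<Suc m. (1 / 2 :: real) ^ i)"
      by (intro sum_mono) (auto simp: power_one_over)
    also have "\<dots> \<le> 2"
      by (subst geometric_sum) (auto simp: field_simps)
    finally show ?thesis using True by linarith
  next
    case False
    then show ?thesis
      using Suc.IH[of "2 * x"] Suc.prems shift by (subst sum.lessThan_Suc_shift) simp
  qed
qed simp

text \<open>At level \<open>i\<close> a strip consists of \<open>2\<^sup>i\<close> tiles, so \<open>j div 2\<^sup>i\<close> is the strip of tile \<open>j\<close>.\<close>

definition tile_set :: "nat \<Rightarrow> nat \<Rightarrow> nat \<Rightarrow> nat set" where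
  "tile_set n i a = {j. j div 2 ^ i < n \<and> j div 2 ^ i mod 2 ^ i = a}"

text \<open>One strip in \<open>2 ^ i\<close> is filled, with \<open>2 ^ i\<close> tiles each, so
  every level has about \<open>N div 2 ^ K\<close> tiles. Columns beyond the last complete strip are
  black.\<close>

definition hard_image :: "nat \<Rightarrow> nat \<Rightarrow> nat \<Rightarrow> nat \<Rightarrow> image" where
  "hard_image N K i a = striped_image N (2 ^ (K - i)) (tile_set (N div 2 ^ K) i a)"

lemma finite_tile_set: "finite (tile_set n i a)"
proof (rule finite_subset)
  show "tile_set n i a \<subseteq> {..<n * 2 ^ i}"
    by (auto simp: tile_set_def div_less_iff_less_mult)
qed simp

lemma card_tile_set:
  assumes "a < 2 ^ i"
  shows "2 ^ i * (n div 2 ^ i) \<le> card (tile_set n i a)"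
proof -
  \<comment> \<open>\<open>f (m, t)\<close> is tile \<open>t\<close> of the filled strip in the
    \<open>m\<close>-th period of \<open>2 ^ i\<close> strips.\<close>
  define f :: "nat \<times> nat \<Rightarrow> nat" where "f = (\<lambda>(m, t). (m * 2 ^ i + a) * 2 ^ i + t)"
  have div_f: "f (m, t) div 2 ^ i = m * 2 ^ i + a" and mod_f: "f (m, t) mod 2 ^ i = t"
    if "t < 2 ^ i" for m t
    using that by (simp_all add: f_def)
  have inj: "inj_on f ({..<n div 2 ^ i} \<times> {..<2 ^ i})"
  proof (rule inj_onI)
    fix x y
    assume *: "x \<in> {..<n div 2 ^ i} \<times> {..<2 ^ i}" "y \<in> {..<n div 2 ^ i} \<times> {..<2 ^ i}" "f x = f y"
    obtain m t m' t' where xy: "x = (m, t)" "y = (m', t')" by (cases x, cases y)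
    then show "x = y"
      using * div_f[of t m] div_f[of t' m'] mod_f[of t m] mod_f[of t' m'] by simp
  qed
  have "f ` ({..<n div 2 ^ i} \<times> {..<2 ^ i}) \<subseteq> tile_set n i a"
  proof clarify
    fix m t :: nat assume mt: "m < n div 2 ^ i" "t < 2 ^ i"
    have "Suc m * 2 ^ i \<le> n"
      using mt(1) by (metis Suc_leI div_times_less_eq_dividend le_trans mult_le_mono1)
    then have "m * 2 ^ i + a < n" using assms by simp
    then show "f (m, t) \<in> tile_set n i a"
      using div_f[OF mt(2), of m] assms by (simp add: tile_set_def)
  qed
  then have "card ({..<n div 2 ^ i} \<times> {..<(2::nat) ^ i}) \<le> card (tile_set n i a)"
    using card_mono[OF finite_tile_set] card_image[OF inj] by metis
  then show ?thesis by (simp add: card_cartesian_product mult.commute)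
qed

lemma tile_set_bound:
  assumes "j \<in> tile_set (N div 2 ^ K) i a" "i \<le> K"
  shows "Suc j * 2 ^ (K - i) \<le> N"
proof -
  have K: "(2::nat) ^ K = 2 ^ i * 2 ^ (K - i)"
    using assms(2) by (simp add: power_add[symmetric])
  have "j div 2 ^ i < N div 2 ^ K" using assms(1) by (simp add: tile_set_def)
  then have "j < N div 2 ^ K * 2 ^ i" by (simp add: div_less_iff_less_mult)
  then have "Suc j * 2 ^ (K - i) \<le> N div 2 ^ K * 2 ^ i * 2 ^ (K - i)"
    by (intro mult_le_mono1) simp
  also have "\<dots> = N div 2 ^ K * 2 ^ K" by (simp add: K mult.assoc)
  also have "\<dots> \<le> N" by simp
  finally show ?thesis .
qed

lemma hard_image_far:
  assumes "i + 2 \<le> K" "a < 2 ^ i" "16 * (2 ^ K)\<^sup>2 \<le> N" "0 < \<epsilon>" "32 * \<epsilon> * 2 ^ K \<le> 1"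
  shows "far_from_connected N \<epsilon> (hard_image N K i a)"
  unfolding far_from_connected_def
proof (intro ballI impI)
  fix M' assume conn: "connected_image N M'"
  define W :: real where "W = 2 ^ K"
  define d where "d = card {p \<in> pixels N. hard_image N K i a p \<noteq> M' p}"
  have W4: "4 \<le> W"
    using power_increasing[of 2 K "2::real"] assms(1) by (simp add: W_def)
  have iW: "2 ^ i \<le> W"
    unfolding W_def using assms(1) by (intro power_increasing) auto
  have NW: "16 * W\<^sup>2 \<le> real N"
    using assms(3)[folded of_nat_le_iff[where 'a = real]] by (simp add: W_def)
  have "4 * W \<le> W\<^sup>2" using W4 by (simp add: power2_eq_square)
  then have N1: "64 * W \<le> real N" "256 \<le> real N" using NW W4 by linarith+
  have w: "3 \<le> (2::nat) ^ (K - i)"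
  proof -
    have "(2::nat) ^ 2 \<le> 2 ^ (K - i)" using assms(1) by (intro power_increasing) auto
    then show ?thesis by simp
  qed
  have "(N div 4) * (2 ^ i * (N div 2 ^ K div 2 ^ i)) \<le> Suc d"
  proof -
    have "(N div 4) * card (tile_set (N div 2 ^ K) i a) \<le> Suc d"
      unfolding d_def hard_image_def
      using tile_set_bound[of _ N K i a] w finite_tile_set conn assms(1)
      by (intro striped_image_distance) auto
    then show ?thesis
      using card_tile_set[OF assms(2), of "N div 2 ^ K"] by (meson le_trans mult_le_mono2)
  qed
  from of_nat_mono[OF this, where 'a = real]
  have "real (N div 4) * (2 ^ i * real (N div 2 ^ K div 2 ^ i)) \<le> 1 + real d"
    by (simp only: of_nat_Suc of_nat_mult of_nat_numeral of_nat_power)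
  moreover have "real N / 8 \<le> real (N div 4)"
  proof -
    have "4 * (N div 4) + 3 \<ge> N" by linarith
    then show ?thesis using N1 by linarith
  qed
  \<comment> \<open>The two roundings lose at most \<open>2 ^ i + 1 \<le> W + 1\<close> from
    \<open>N / W\<close>, whose half is at least \<open>8 * W\<close>.\<close>
  moreover have "real N / (2 * W) \<le> 2 ^ i * real (N div 2 ^ K div 2 ^ i)"
  proof -
    have floor: "real x / real y - 1 \<le> real (x div y)" for x y :: nat
      using floor_divide_of_nat_eq[of x y, where 'a = real] by linarith
    have "real (N div 2 ^ K) / 2 ^ i - 1 \<le> real (N div 2 ^ K div 2 ^ i)"
      using floor[of "N div 2 ^ K" "2 ^ i"] by simp
    then have "real (N div 2 ^ K) - 2 ^ i \<le> 2 ^ i * real (N div 2 ^ K div 2 ^ i)"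
      by (simp add: field_simps)
    moreover have "real N / W - 1 \<le> real (N div 2 ^ K)"
      using floor[of N "2 ^ K"] by (simp add: W_def)
    moreover have "16 * W \<le> real N / W"
      using NW W4 by (simp add: field_simps power2_eq_square)
    moreover have "real N / (2 * W) = real N / W / 2" by simp
    ultimately show ?thesis using iW W4 by linarith
  qed
  moreover have "0 \<le> real N / (2 * W)" using W4 by simp
  ultimately have "real N / 8 * (real N / (2 * W)) \<le> 1 + real d"
    by (meson mult_mono order_trans of_nat_0_le_iff)
  then have d: "(real N)\<^sup>2 / (16 * W) \<le> 1 + real d"
    by (simp add: power2_eq_square)
  \<comment> \<open>Half of the lower bound \<open>d\<close> absorbs the one exceptional block; the
    other half is at least \<open>\<epsilon> * N\<^sup>2\<close>.\<close>
  have "1 \<le> (real N)\<^sup>2 / (32 * W)"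
  proof -
    have "real N \<le> (real N)\<^sup>2"
      using N1 by (intro self_le_power) auto
    then have "32 * W \<le> (real N)\<^sup>2" using N1 W4 by linarith
    then show ?thesis using W4 by simp
  qed
  moreover have "\<epsilon> * (real N)\<^sup>2 \<le> (real N)\<^sup>2 / (32 * W)"
  proof -
    have "\<epsilon> \<le> 1 / (32 * W)" using assms(5) W4 by (simp add: W_def field_simps)
    then show ?thesis using mult_right_mono[of \<epsilon> "1 / (32 * W)" "(real N)\<^sup>2"] by simp
  qed
  moreover have "(real N)\<^sup>2 / (16 * W) = 2 * ((real N)\<^sup>2 / (32 * W))" by simp
  ultimately show "\<epsilon> * (real N)\<^sup>2 \<le> real (card {p \<in> pixels N. hard_image N K i a p \<noteq> M' p})"
    using d unfolding d_def[symmetric] by linarith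
qed

section \<open>Queries needed to refute connectedness\<close>

text \<open>By \<open>striped_image_patch\<close>, a refutation requires some row of some tile whose
  \<open>w - 2\<close> interior pixels are all queried. For \<open>w \<ge> 4\<close> this is at
  least \<open>w / 2\<close> queries, all in one filled strip.\<close>

lemma refuting_queries_hit_strip:
  assumes "i + 2 \<le> K" "Q \<subseteq> pixels N"
    and refutes: "\<And>M'. M' \<in> images N \<Longrightarrow> connected_image N M' \<Longrightarrow>
      restrict M' Q \<noteq> restrict (hard_image N K i a) Q"
  shows "\<exists>s < N div 2 ^ K. s mod 2 ^ i = a \<and> 2 ^ (K - 1 - i) \<le> card {p \<in> Q. snd p div 2 ^ K = s}"
proof -
  define w :: nat where "w = 2 ^ (K - i)"
  define J where "J = tile_set (N div 2 ^ K) i a"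
  have Kw: "(2::nat) ^ K = w * 2 ^ i"
    using assms(1) by (simp add: w_def power_add[symmetric])
  have w2: "w = 2 * 2 ^ (K - 1 - i)"
  proof -
    have "K - i = Suc (K - 1 - i)" using assms(1) by linarith
    then show ?thesis by (simp add: w_def)
  qed
  have "2 ^ 1 \<le> (2::nat) ^ (K - 1 - i)"
    using assms(1) by (intro power_increasing) auto
  then have w4: "4 \<le> w" using w2 by simp
  have "\<exists>r j. j \<in> J \<and> (\<forall>c. c div w = j \<and> interior_col w c \<longrightarrow> (r, c) \<in> Q)"
  proof (rule ccontr)
    assume "\<not> ?thesis"
    then have "\<exists>M' \<in> images N. connected_image N M' \<and>
           (\<forall>p \<in> Q \<inter> pixels N. M' p = striped_image N w J p)"
      using tile_set_bound[of _ N K i a] assms(1)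
      by (intro striped_image_patch) (auto simp: J_def w_def)
    then obtain M' where M': "M' \<in> images N" "connected_image N M'"
      "\<forall>p \<in> Q \<inter> pixels N. M' p = striped_image N w J p" by blast
    have "restrict M' Q = restrict (hard_image N K i a) Q"
      using M'(3) assms(2) by (intro restrict_ext) (auto simp: hard_image_def w_def J_def)
    then show False using refutes M' by blast
  qed
  then obtain r j where j: "j \<in> J" and Q: "\<And>c. c div w = j \<Longrightarrow> interior_col w c \<Longrightarrow> (r, c) \<in> Q"
    by blast
  let ?s = "j div 2 ^ i"
  have "(\<lambda>t. (r, Suc t + j * w)) ` {..<w - 2} \<subseteq> {p \<in> Q. snd p div 2 ^ K = ?s}"
  proof clarify
    fix t assume t: "t < w - 2"
    have "(Suc t + j * w) div w = j" "(Suc t + j * w) mod w = Suc t"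
      using t by (intro div_mod_tile; linarith)+
    moreover from this have "interior_col w (Suc t + j * w)"
      unfolding interior_col_def using t by linarith
    ultimately show "(r, Suc t + j * w) \<in> Q \<and> snd (r, Suc t + j * w) div 2 ^ K = ?s"
      using Q by (simp only: Kw snd_conv div_mult2_eq)
  qed
  moreover have "finite {p \<in> Q. snd p div 2 ^ K = ?s}"
    by (rule finite_subset[of _ "pixels N"]) (use assms(2) in \<open>auto simp: pixels_def\<close>)
  ultimately have "card ((\<lambda>t. (r, Suc t + j * w)) ` {..<w - 2}) \<le> card {p \<in> Q. snd p div 2 ^ K = ?s}"
    by (intro card_mono)
  moreover have "card ((\<lambda>t. (r, Suc t + j * w)) ` {..<w - 2}) = w - 2"
    by (subst card_image) (auto simp: inj_on_def)
  moreover have "2 ^ (K - 1 - i) \<le> w - 2" using w2 w4 by linarith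
  ultimately show ?thesis
    using j by (intro exI[of _ ?s]) (auto simp: J_def tile_set_def)
qed

text \<open>\<open>R i a\<close> marks hard images refuted by the answers on \<open>Q\<close>. At
  level \<open>i\<close> each marked residue is charged to a strip with
  \<open>2 ^ (K - 1 - i)\<close> queries or more. Exchanging the sums, a strip with
  \<open>q s\<close> queries pays a geometric series of size at most
  \<open>2 * q s / 2 ^ (K - 1)\<close>.\<close>

lemma weighted_refutations_le:
  assumes Q: "Q \<subseteq> pixels N"
    and refutes: "\<And>i a M'. R i a \<Longrightarrow> M' \<in> images N \<Longrightarrow> connected_image N M' \<Longrightarrow>
      restrict M' Q \<noteq> restrict (hard_image N K i a) Q"
  shows "(\<Sum>i<K - 1. \<Sum>a<2 ^ i. (if R i a then 1 else 0) / 2 ^ i) \<le> 4 * real (card Q) / 2 ^ K"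
proof -
  define n where "n = N div 2 ^ K"
  define q where "q s = card {p \<in> Q. snd p div 2 ^ K = s}" for s
  have finQ: "finite Q" using Q by (auto intro: finite_subset simp: pixels_def)
  have level: "(\<Sum>a<2 ^ i. (if R i a then 1 else 0) / 2 ^ i)
      \<le> (\<Sum>s<n. if 1 / 2 ^ i \<le> real (q s) / 2 ^ (K - 1) then 1 / 2 ^ i else (0::real))"
    if i: "i < K - 1" for i
  proof -
    let ?S = "{s. s < n \<and> 2 ^ (K - 1 - i) \<le> q s}"
    \<comment> \<open>A strip is filled for only one residue, so there are no more marked residues
      than heavily queried strips.\<close>
    have "{a. a < 2 ^ i \<and> R i a} \<subseteq> (\<lambda>s. s mod 2 ^ i) ` ?S"
      using refuting_queries_hit_strip[OF _ Q refutes, of i] i by (fastforce simp: n_def q_def)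
    then have card: "card {a. a < 2 ^ i \<and> R i a} \<le> card ?S"
      by (intro surj_card_le) auto
    have pow: "1 / 2 ^ i \<le> real x / 2 ^ (K - 1) \<longleftrightarrow> 2 ^ (K - 1 - i) \<le> x" for x :: nat
    proof -
      have "(2::real) ^ (K - 1) = 2 ^ (K - 1 - i) * 2 ^ i"
        using i by (simp add: power_add[symmetric])
      then have "1 / 2 ^ i \<le> real x / 2 ^ (K - 1) \<longleftrightarrow> 2 ^ (K - 1 - i) \<le> real x"
        by (simp add: field_simps)
      then show ?thesis
        by (metis of_nat_le_iff of_nat_numeral of_nat_power)
    qed
    have "(\<Sum>a<2 ^ i. (if R i a then 1 else 0) / 2 ^ i :: real) = real (card {a. a < 2 ^ i \<and> R i a}) / 2 ^ i"
      by (simp add: sum_divide_distrib[symmetric] sum.If_cases Int_def)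
    also have "\<dots> \<le> real (card ?S) / 2 ^ i"
      using card by (simp add: divide_right_mono)
    also have "\<dots> = (\<Sum>s<n. if 1 / 2 ^ i \<le> real (q s) / 2 ^ (K - 1) then 1 / 2 ^ i else 0)"
      unfolding pow by (simp add: sum.If_cases Int_def)
    finally show ?thesis .
  qed
  have "(\<Sum>i<K - 1. \<Sum>a<2 ^ i. (if R i a then 1 else 0) / 2 ^ i)
      \<le> (\<Sum>i<K - 1. \<Sum>s<n. if 1 / 2 ^ i \<le> real (q s) / 2 ^ (K - 1) then 1 / 2 ^ i else (0::real))"
    using level by (intro sum_mono) auto
  also have "\<dots> = (\<Sum>s<n. \<Sum>i<K - 1. if 1 / 2 ^ i \<le> real (q s) / 2 ^ (K - 1) then 1 / 2 ^ i else 0)"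
    by (rule sum.swap)
  also have "\<dots> \<le> (\<Sum>s<n. 2 * (real (q s) / 2 ^ (K - 1)))"
    by (intro sum_mono sum_large_reciprocal_powers) auto
  also have "\<dots> = 2 * real (\<Sum>s<n. q s) / 2 ^ (K - 1)"
    by (simp add: sum_distrib_left sum_divide_distrib)
  also have "(\<Sum>s<n. q s) = card (\<Union>s<n. {p \<in> Q. snd p div 2 ^ K = s})"
    unfolding q_def using finQ by (subst card_UN_disjoint) auto
  also have "2 * real \<dots> / 2 ^ (K - 1) \<le> 2 * real (card Q) / 2 ^ (K - 1)"
    using finQ by (intro divide_right_mono mult_left_mono) (auto intro!: card_mono)
  \<comment> \<open>Equality holds except for \<open>K = 0\<close>, where the subtraction
    truncates.\<close>
  also have "\<dots> \<le> 4 * real (card Q) / 2 ^ K"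
    by (cases K) auto
  finally show ?thesis .
qed

section \<open>Averaging over the random choices of the tester\<close>

text \<open>Rejection probabilities, averaged over the residues and summed over the
  \<open>K - 1\<close> levels, are at least \<open>2 / 3\<close> per level. Their total is an
  expectation, bounded for each outcome of the randomness by
  \<open>weighted_refutations_le\<close>.\<close>

lemma query_complexity_lower_bound:
  assumes T: "one_sided_nonadaptive_tester N \<epsilon> T"
    and "16 * (2 ^ K)\<^sup>2 \<le> N" "0 < \<epsilon>" "32 * \<epsilon> * 2 ^ K \<le> 1" "1 \<le> K"
  shows "(real K - 1) * 2 ^ K / 6 \<le> real (query_complexity T)"
proof -
  have within: "Q \<subseteq> pixels N" if "(Q, D) \<in> set_pmf T" for Q D
    using T that by (auto simp: one_sided_nonadaptive_tester_def queries_within_def)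
  \<comment> \<open>Acceptance with probability 1 means acceptance by every pair in the
    support.\<close>
  have acc: "D (restrict M Q)"
    if "(Q, D) \<in> set_pmf T" "M \<in> images N" "connected_image N M" for Q D M
  proof -
    have "measure_pmf.prob T {(Q, D). D (restrict M Q)} = 1"
      using T that by (auto simp: one_sided_nonadaptive_tester_def accept_prob_def)
    then have "AE x in measure_pmf T. x \<in> {(Q, D). D (restrict M Q)}"
      by (subst (asm) measure_pmf.prob_eq_1) auto
    then show ?thesis using that(1) by (auto simp: AE_measure_pmf_iff)
  qed
  have qc: "card Q \<le> query_complexity T" if "(Q, D) \<in> set_pmf T" for Q D
  proof -
    have "(\<lambda>(Q, D). card Q) ` set_pmf T \<subseteq> {..card (pixels N)}"
      using within by (auto intro!: card_mono) (simp add: pixels_def)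
    then have "finite ((\<lambda>(Q, D). card Q) ` set_pmf T)"
      using finite_subset by blast
    then show ?thesis
      unfolding query_complexity_def using that by (force intro: Max_ge)
  qed
  define rej :: "nat \<Rightarrow> nat \<Rightarrow> (pixel set \<times> ((pixel \<Rightarrow> bool) \<Rightarrow> bool)) set" where
    "rej i a = {(Q, D). \<not> D (restrict (hard_image N K i a) Q)}" for i a
  have far: "2 / 3 \<le> measure_pmf.prob T (rej i a)" if "i < K - 1" "a < 2 ^ i" for i a
  proof -
    have "far_from_connected N \<epsilon> (hard_image N K i a)"
      using that assms by (intro hard_image_far) auto
    moreover have "hard_image N K i a \<in> images N"
      by (simp add: hard_image_def striped_image_in_images)
    ultimately show ?thesis
      using T by (simp add: one_sided_nonadaptive_tester_def reject_prob_def rej_def)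
  qed
  have int: "integrable (measure_pmf T) (\<lambda>x. indicat_real (rej i a) x / 2 ^ i)" for i a
    by (intro measure_pmf.integrable_const_bound[where B = 1]) (auto simp: indicator_def)
  have "(real K - 1) * (2 / 3) = (\<Sum>i<K - 1. \<Sum>a<(2::nat) ^ i. (2 / 3) / 2 ^ i)"
    using \<open>1 \<le> K\<close> by (simp add: of_nat_diff)
  also have "\<dots> \<le> (\<Sum>i<K - 1. \<Sum>a<2 ^ i. measure_pmf.prob T (rej i a) / 2 ^ i)"
    using far by (intro sum_mono divide_right_mono) auto
  also have "\<dots> = measure_pmf.expectation T (\<lambda>x. \<Sum>i<K - 1. \<Sum>a<2 ^ i. indicator (rej i a) x / 2 ^ i)"
    by (subst Bochner_Integration.integral_sum, intro Bochner_Integration.integrable_sum int)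
      (simp add: Bochner_Integration.integral_sum[OF int])
  also have "\<dots> \<le> measure_pmf.expectation T (\<lambda>_. 4 * real (query_complexity T) / 2 ^ K)"
  proof (intro integral_mono_AE)
    show "AE x in measure_pmf T. (\<Sum>i<K - 1. \<Sum>a<2 ^ i. indicator (rej i a) x / 2 ^ i)
        \<le> 4 * real (query_complexity T) / 2 ^ K"
    proof (subst AE_measure_pmf_iff, rule ballI)
      fix x assume x: "x \<in> set_pmf T"
      obtain Q D where QD: "x = (Q, D)" by (cases x)
      have "(\<Sum>i<K - 1. \<Sum>a<2 ^ i. (if x \<in> rej i a then 1 else 0) / 2 ^ i) \<le> 4 * real (card Q) / 2 ^ K"
      proof (rule weighted_refutations_le)
        show "Q \<subseteq> pixels N" using within x QD by blast
        \<comment> \<open>A connected image with the same answers would be rejected as well,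
          contradicting \<open>acc\<close>.\<close>
        show "restrict M' Q \<noteq> restrict (hard_image N K i a) Q"
          if "x \<in> rej i a" "M' \<in> images N" "connected_image N M'" for i a M'
          using acc[of Q D M'] x QD that by (auto simp: rej_def)
      qed
      also have "\<dots> \<le> 4 * real (query_complexity T) / 2 ^ K"
        using qc[of Q D] x QD by (intro divide_right_mono) auto
      finally show "(\<Sum>i<K - 1. \<Sum>a<2 ^ i. indicator (rej i a) x / 2 ^ i)
          \<le> 4 * real (query_complexity T) / 2 ^ K"
        by (simp add: indicator_def of_bool_def)
    qed
  qed (auto intro!: Bochner_Integration.integrable_sum int)
  also have "\<dots> = 4 * real (query_complexity T) / 2 ^ K" by simp
  finally show ?thesis by (simp add: field_simps)
qed

theorem theorem1p2:
  "\<exists>c > (0::real). \<exists>\<epsilon>\<^sub>0 > (0::real). \<forall>\<epsilon>. 0 < \<epsilon> \<and> \<epsilon> \<le> \<epsilon>\<^sub>0 \<longrightarrow>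
     (\<exists>N\<^sub>0. \<forall>N \<ge> N\<^sub>0. \<forall>T. one_sided_nonadaptive_tester N \<epsilon> T \<longrightarrow>
        real (query_complexity T) \<ge> c * (1 / \<epsilon> * ln (1 / \<epsilon>)))"
proof -
  \<comment> \<open>The constant is \<open>768 = 6 * 2 * 64\<close>: 6 from the query bound, 2 from
    \<open>ln (1 / \<epsilon>) / 2 \<le> K - 1\<close>, and 64 from the lower bound on
    \<open>2 ^ K\<close>.\<close>
  have "c / 768 \<le> y" if "c = 1 / \<epsilon> * ln (1 / \<epsilon>)" "0 < \<epsilon>" "40 \<le> ln (1 / \<epsilon>)"
    "(real K - 1) * 2 ^ K / 6 \<le> y" "1 / (64 * \<epsilon>) \<le> 2 ^ K" for c \<epsilon> y :: real and K :: nat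
  proof -
    have "1 / \<epsilon> \<le> 2 ^ (K + 6)" using that(5) by (simp add: power_add)
    then have "ln (1 / \<epsilon>) \<le> ln (2 ^ (K + 6))" using that(2) by (subst ln_le_cancel_iff) auto
    also have "\<dots> = real (K + 6) * ln 2" by (simp add: ln_realpow)
    also have "\<dots> \<le> real (K + 6) * 1" using ln_2_less_1 by (intro mult_left_mono) auto
    finally have "ln (1 / \<epsilon>) / 2 \<le> real K - 1" using that(3) by simp
    then have "ln (1 / \<epsilon>) / 2 * (1 / (64 * \<epsilon>)) \<le> (real K - 1) * 2 ^ K"
      using that by (intro mult_mono) auto
    then show ?thesis using that(1,4) by simp
  qed
  note arith = this
  show ?thesis
  proof (rule exI[of _ "1 / 768"], intro conjI, simp, rule exI[of _ "exp (- 40)"],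
      intro conjI, simp, intro allI impI)
    fix \<epsilon> :: real assume \<epsilon>: "0 < \<epsilon> \<and> \<epsilon> \<le> exp (- 40)"
    then have inv: "exp 40 \<le> 1 / \<epsilon>"
      by (simp add: exp_minus field_simps)
    have "1 + 40 \<le> exp (40::real)" by (rule exp_ge_add_one_self)
    then have "32 \<le> 1 / \<epsilon>" using inv by linarith
    then have large: "1 \<le> 1 / (32 * \<epsilon>)" using \<epsilon> by (simp add: field_simps)
    have ln: "40 \<le> ln (1 / \<epsilon>)" using inv \<epsilon> by (subst ln_ge_iff) auto
    \<comment> \<open>\<open>2 ^ K\<close> will be the largest power of two up to
      \<open>1 / (32 * \<epsilon>)\<close>: small enough for the hard images to be far, and within a
      factor 2 of that limit.\<close>
    define m where "m = nat \<lfloor>1 / (32 * \<epsilon>)\<rfloor>"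
    have m: "1 \<le> m" "real m \<le> 1 / (32 * \<epsilon>)" "1 / (32 * \<epsilon>) < real m + 1"
      using large unfolding m_def by linarith+
    obtain K where K: "2 ^ K \<le> m" "m < 2 ^ (K + 1)"
      using ex_power_ivl1[of 2 m] m(1) by auto
    have "2 ^ K \<le> real m" using of_nat_mono[OF K(1), where 'a = real] by simp
    then have "2 ^ K \<le> 1 / (32 * \<epsilon>)" using m(2) by linarith
    then have up: "32 * \<epsilon> * 2 ^ K \<le> 1" using \<epsilon> by (simp add: field_simps)
    have "real m + 1 \<le> real (2 ^ (K + 1))" using K(2) by linarith
    then have "1 / (32 * \<epsilon>) \<le> 2 * 2 ^ K" using m(3) by simp
    then have low: "1 / (64 * \<epsilon>) \<le> 2 ^ K" using \<epsilon> by (simp add: field_simps)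
    have "1 \<le> K"
    proof (rule ccontr)
      assume "\<not> 1 \<le> K"
      then have "K = 0" by simp
      then have "1 / \<epsilon> \<le> 64" using low \<epsilon> by (simp add: field_simps)
      moreover have "(1 + 20)\<^sup>2 \<le> (exp (20::real))\<^sup>2"
        by (intro power_mono exp_ge_add_one_self) auto
      moreover have "(exp (20::real))\<^sup>2 = exp 40" by (simp flip: exp_double)
      ultimately show False using inv by simp
    qed
    show "\<exists>N\<^sub>0. \<forall>N \<ge> N\<^sub>0. \<forall>T. one_sided_nonadaptive_tester N \<epsilon> T \<longrightarrow>
        real (query_complexity T) \<ge> 1 / 768 * (1 / \<epsilon> * ln (1 / \<epsilon>))"
    proof (intro exI[of _ "16 * (2 ^ K)\<^sup>2"] allI impI)
      fix N T assume "16 * (2 ^ K)\<^sup>2 \<le> N" "one_sided_nonadaptive_tester N \<epsilon> T"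
      then have "(real K - 1) * 2 ^ K / 6 \<le> real (query_complexity T)"
        using \<epsilon> up \<open>1 \<le> K\<close> by (intro query_complexity_lower_bound) auto
      from arith[OF refl _ ln this low] \<epsilon>
      show "real (query_complexity T) \<ge> 1 / 768 * (1 / \<epsilon> * ln (1 / \<epsilon>))" by simp
    qed
  qed
qed

end
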